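(* The pair $(\ell_\infty^3,\ell_1^3)$ of real Banach spaces has the non-trivial norm preserving uniform BPB approximation property.
   Context: $\mathbb{L}(\mathbb{X},\mathbb{Y})$ is the space of bounded linear operators with the operator norm; $S_Z$ is the unit sphere of a normed space $Z$; $\mathrm{Iso}(\mathbb{X},\mathbb{Y})$ is the (possibly empty) set of linear isometries from $\mathbb{X}$ to $\mathbb{Y}$. For $A\in\mathbb{L}(\mathbb{X},\mathbb{Y})$, $M_A=\{x\in S_{\mathbb{X}}:\|Ax\|=\|A\|\}$. For $T\in S_{\mathbb{L}(\mathbb{X},\mathbb{Y})}$ and $\epsilon>0$, an operator $A\in S_{\mathbb{L}(\mathbb{X},\mathbb{Y})}$ is a uniform $\epsilon$-BPB approximation of $T$ if $\|T-A\|<\epsilon$ and there exists $\delta(\epsilon)>0$ such that for each $x_0\in S_{\mathbb{X}}$ with $\|Tx_0\|>1-\delta(\epsilon)$ there exists $u_0\in M_A$ with $\|u_0-x_0\|<\epsilon$. It is non-trivial if in addition $A\neq T$. The pair $(\mathbb{X},\mathbb{Y})$ has the non-trivial norm preserving uniform BPB approximation property if for every $T\in S_{\mathbb{L}(\mathbb{X},\mathbb{Y})}\setminus\mathrm{Iso}(\mathbb{X},\mathbb{Y})$ and every $\epsilon>0$, $T$ admits a non-trivial uniform $\epsilon$-BPB approximation $A_\epsilon$ with $M_T=M_{A_\epsilon}$. *)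

theory Defs
  imports "HOL-Analysis.Analysis"
begin

text \<open>
  \<open>\<ell>\<^sub>\<infinity>\<^sup>n\<close> and \<open>\<ell>\<^sub>1\<^sup>n\<close>: copies of \<^typ>\<open>real ^ 'n\<close>, where \<open>n = CARD('n)\<close>, carrying the sup norm and
  the sum norm instead of the Euclidean norm. Thus \<open>3 linf\<close> is \<open>\<ell>\<^sub>\<infinity>\<^sup>3\<close> and \<open>3 l1\<close> is \<open>\<ell>\<^sub>1\<^sup>3\<close>.
\<close>

typedef 'n linf = "UNIV :: (real ^ 'n) set"
  morphisms linf_vec linf_of_vec ..

setup_lifting type_definition_linf

instantiation linf :: (finite) real_normed_vector
begin

lift_definition zero_linf :: "'a linf" is 0 .
lift_definition plus_linf :: "'a linf \<Rightarrow> 'a linf \<Rightarrow> 'a linf" is "(+)" .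
lift_definition minus_linf :: "'a linf \<Rightarrow> 'a linf \<Rightarrow> 'a linf" is "(-)" .
lift_definition uminus_linf :: "'a linf \<Rightarrow> 'a linf" is uminus .
lift_definition scaleR_linf :: "real \<Rightarrow> 'a linf \<Rightarrow> 'a linf" is "(*\<^sub>R)" .
lift_definition norm_linf :: "'a linf \<Rightarrow> real" is "infnorm" .

definition dist_linf :: "'a linf \<Rightarrow> 'a linf \<Rightarrow> real"
  where "dist_linf x y = norm (x - y)"

definition sgn_linf :: "'a linf \<Rightarrow> 'a linf"
  where "sgn_linf x = inverse (norm x) *\<^sub>R x"

definition [code del]:
  "(uniformity :: ('a linf \<times> 'a linf) filter) = (INF e\<in>{0 <..}. principal {(x, y). dist x y < e})"

definition open_linf :: "'a linf set \<Rightarrow> bool"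
  where [code del]: "open_linf S = (\<forall>x\<in>S. \<forall>\<^sub>F (x', y) in uniformity. x' = x \<longrightarrow> y \<in> S)"

instance
proof
  fix x y :: "'a linf" and r :: real
  show "norm x = 0 \<longleftrightarrow> x = 0"
    by transfer (rule infnorm_eq_0)
  show "norm (x + y) \<le> norm x + norm y"
    by transfer (rule infnorm_triangle)
  show "norm (r *\<^sub>R x) = \<bar>r\<bar> * norm x"
    by transfer (rule infnorm_mul)
qed ((transfer; simp add: algebra_simps scaleR_add_left scaleR_add_right; fail) |
    simp add: dist_linf_def sgn_linf_def uniformity_linf_def open_linf_def)+

end

instance linf :: (finite) banach
proof
  fix X :: "nat \<Rightarrow> 'a linf"
  assume X: "Cauchy X"
  obtain C where C: "\<And>x :: 'a linf. norm (linf_vec x) \<le> C * norm x" "C > 0"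
  proof
    show "norm (linf_vec x) \<le> sqrt DIM(real ^ 'a) * norm x" for x :: "'a linf"
      by (simp only: norm_linf.rep_eq norm_le_infnorm)
    show "sqrt DIM(real ^ 'a) > 0" by simp
  qed
  obtain D where D: "\<And>x :: 'a linf. norm x \<le> D * norm (linf_vec x)" "D > 0"
  proof
    show "norm x \<le> 1 * norm (linf_vec x)" for x :: "'a linf"
      by (simp add: norm_linf.rep_eq infnorm_le_norm)
    show "(1::real) > 0" by simp
  qed
  have "Cauchy (\<lambda>n. linf_vec (X n))"
  proof (rule CauchyI)
    fix e :: real
    assume "0 < e"
    with C(2) have "0 < e / C" by simp
    from CauchyD[OF X this] obtain M
      where M: "\<And>m n. m \<ge> M \<Longrightarrow> n \<ge> M \<Longrightarrow> norm (X m - X n) < e / C" by blast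
    have "norm (linf_vec (X m) - linf_vec (X n)) < e" if "m \<ge> M" "n \<ge> M" for m n
    proof -
      have "norm (linf_vec (X m) - linf_vec (X n)) \<le> C * norm (X m - X n)"
        using C(1)[of "X m - X n"] by (simp add: minus_linf.rep_eq)
      also have "\<dots> < e"
        using M[OF that] C(2) by (simp add: field_simps)
      finally show ?thesis .
    qed
    then show "\<exists>M. \<forall>m\<ge>M. \<forall>n\<ge>M. norm (linf_vec (X m) - linf_vec (X n)) < e" by blast
  qed
  then obtain L where "(\<lambda>n. linf_vec (X n)) \<longlonglongrightarrow> L"
    using Cauchy_convergent convergent_def by blast
  then have lim: "(\<lambda>n. D * norm (linf_vec (X n) - L)) \<longlonglongrightarrow> 0"
    by (metis LIM_zero tendsto_norm_zero tendsto_mult_right_zero)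
  have "(\<lambda>n. X n - linf_of_vec L) \<longlonglongrightarrow> 0"
  proof (rule Lim_null_comparison[OF _ lim], rule always_eventually, rule allI)
    fix n
    show "norm (X n - linf_of_vec L) \<le> D * norm (linf_vec (X n) - L)"
      using D(1)[of "X n - linf_of_vec L"] by (simp add: minus_linf.rep_eq linf_of_vec_inverse)
  qed
  then show "convergent X"
    by (auto simp: convergent_def dest: LIM_zero_cancel)
qed

lemma norm_linf_eq_Max: "norm x = Max (range (\<lambda>i. \<bar>linf_vec x $ i\<bar>))"
proof -
  have "{\<bar>linf_vec x $ i\<bar> |i. i \<in> UNIV} = range (\<lambda>i. \<bar>linf_vec x $ i\<bar>)" by auto
  then show ?thesis
    by (simp add: norm_linf.rep_eq infnorm_cart cSup_eq_Max)
qed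


typedef 'n l1 = "UNIV :: (real ^ 'n) set"
  morphisms l1_vec l1_of_vec ..

setup_lifting type_definition_l1

instantiation l1 :: (finite) real_normed_vector
begin

lift_definition zero_l1 :: "'a l1" is 0 .
lift_definition plus_l1 :: "'a l1 \<Rightarrow> 'a l1 \<Rightarrow> 'a l1" is "(+)" .
lift_definition minus_l1 :: "'a l1 \<Rightarrow> 'a l1 \<Rightarrow> 'a l1" is "(-)" .
lift_definition uminus_l1 :: "'a l1 \<Rightarrow> 'a l1" is uminus .
lift_definition scaleR_l1 :: "real \<Rightarrow> 'a l1 \<Rightarrow> 'a l1" is "(*\<^sub>R)" .
lift_definition norm_l1 :: "'a l1 \<Rightarrow> real" is "\<lambda>v. \<Sum>i\<in>UNIV. \<bar>v $ i\<bar>" .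

definition dist_l1 :: "'a l1 \<Rightarrow> 'a l1 \<Rightarrow> real"
  where "dist_l1 x y = norm (x - y)"

definition sgn_l1 :: "'a l1 \<Rightarrow> 'a l1"
  where "sgn_l1 x = inverse (norm x) *\<^sub>R x"

definition [code del]:
  "(uniformity :: ('a l1 \<times> 'a l1) filter) = (INF e\<in>{0 <..}. principal {(x, y). dist x y < e})"

definition open_l1 :: "'a l1 set \<Rightarrow> bool"
  where [code del]: "open_l1 S = (\<forall>x\<in>S. \<forall>\<^sub>F (x', y) in uniformity. x' = x \<longrightarrow> y \<in> S)"

instance
proof
  fix x y :: "'a l1" and r :: real
  show "norm x = 0 \<longleftrightarrow> x = 0"
    by transfer (simp add: vec_eq_iff sum_nonneg_eq_0_iff)
  show "norm (x + y) \<le> norm x + norm y"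
    by transfer (simp add: sum_mono abs_triangle_ineq flip: sum.distrib)
  show "norm (r *\<^sub>R x) = \<bar>r\<bar> * norm x"
    by transfer (simp add: abs_mult sum_distrib_left)
qed ((transfer; simp add: algebra_simps scaleR_add_left scaleR_add_right; fail) |
    simp add: dist_l1_def sgn_l1_def uniformity_l1_def open_l1_def)+

end

instance l1 :: (finite) banach
proof
  fix X :: "nat \<Rightarrow> 'a l1"
  assume X: "Cauchy X"
  obtain C where C: "\<And>x :: 'a l1. norm (l1_vec x) \<le> C * norm x" "C > 0"
  proof
    show "norm (l1_vec x) \<le> 1 * norm x" for x :: "'a l1"
      using norm_le_l1_cart[of "l1_vec x"] by (simp add: norm_l1.rep_eq)
    show "(1::real) > 0" by simp
  qed
  obtain D where D: "\<And>x :: 'a l1. norm x \<le> D * norm (l1_vec x)" "D > 0"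
  proof
    show "norm x \<le> real CARD('a) * norm (l1_vec x)" for x :: "'a l1"
      unfolding norm_l1.rep_eq by (rule sum_bounded_above) (rule component_le_norm_cart)
    show "real CARD('a) > 0" by simp
  qed
  have "Cauchy (\<lambda>n. l1_vec (X n))"
  proof (rule CauchyI)
    fix e :: real
    assume "0 < e"
    with C(2) have "0 < e / C" by simp
    from CauchyD[OF X this] obtain M
      where M: "\<And>m n. m \<ge> M \<Longrightarrow> n \<ge> M \<Longrightarrow> norm (X m - X n) < e / C" by blast
    have "norm (l1_vec (X m) - l1_vec (X n)) < e" if "m \<ge> M" "n \<ge> M" for m n
    proof -
      have "norm (l1_vec (X m) - l1_vec (X n)) \<le> C * norm (X m - X n)"
        using C(1)[of "X m - X n"] by (simp add: minus_l1.rep_eq)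
      also have "\<dots> < e"
        using M[OF that] C(2) by (simp add: field_simps)
      finally show ?thesis .
    qed
    then show "\<exists>M. \<forall>m\<ge>M. \<forall>n\<ge>M. norm (l1_vec (X m) - l1_vec (X n)) < e" by blast
  qed
  then obtain L where "(\<lambda>n. l1_vec (X n)) \<longlonglongrightarrow> L"
    using Cauchy_convergent convergent_def by blast
  then have lim: "(\<lambda>n. D * norm (l1_vec (X n) - L)) \<longlonglongrightarrow> 0"
    by (metis LIM_zero tendsto_norm_zero tendsto_mult_right_zero)
  have "(\<lambda>n. X n - l1_of_vec L) \<longlonglongrightarrow> 0"
  proof (rule Lim_null_comparison[OF _ lim], rule always_eventually, rule allI)
    fix n
    show "norm (X n - l1_of_vec L) \<le> D * norm (l1_vec (X n) - L)"
      using D(1)[of "X n - l1_of_vec L"] by (simp add: minus_l1.rep_eq l1_of_vec_inverse)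
  qed
  then show "convergent X"
    by (auto simp: convergent_def dest: LIM_zero_cancel)
qed


definition norm_attainment_set ::
    "('a::real_normed_vector \<Rightarrow>\<^sub>L 'b::real_normed_vector) \<Rightarrow> 'a set"
  where "norm_attainment_set A = {x \<in> sphere 0 1. norm (blinfun_apply A x) = norm A}"

text \<open>Linear isometries are norm preserving but need not be surjective.\<close>

definition linear_isometries :: "('a::real_normed_vector \<Rightarrow>\<^sub>L 'b::real_normed_vector) set"
  where "linear_isometries = {T. \<forall>x. norm (blinfun_apply T x) = norm x}"

definition uniform_BPB_approximation ::
    "real \<Rightarrow> ('a::real_normed_vector \<Rightarrow>\<^sub>L 'b::real_normed_vector) \<Rightarrow> ('a \<Rightarrow>\<^sub>L 'b) \<Rightarrow> bool"
  where "uniform_BPB_approximation \<epsilon> T A \<longleftrightarrow>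
    A \<in> sphere 0 1 \<and> norm (T - A) < \<epsilon> \<and>
    (\<exists>\<delta>>0. \<forall>x0 \<in> sphere 0 1. norm (blinfun_apply T x0) > 1 - \<delta> \<longrightarrow>
      (\<exists>u0 \<in> norm_attainment_set A. norm (u0 - x0) < \<epsilon>))"

definition nontrivial_uniform_BPB_approximation ::
    "real \<Rightarrow> ('a::real_normed_vector \<Rightarrow>\<^sub>L 'b::real_normed_vector) \<Rightarrow> ('a \<Rightarrow>\<^sub>L 'b) \<Rightarrow> bool"
  where "nontrivial_uniform_BPB_approximation \<epsilon> T A \<longleftrightarrow>
    uniform_BPB_approximation \<epsilon> T A \<and> A \<noteq> T"

definition nontrivial_norm_preserving_uniform_BPB_property ::
    "'a::real_normed_vector itself \<Rightarrow> 'b::real_normed_vector itself \<Rightarrow> bool"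
  where "nontrivial_norm_preserving_uniform_BPB_property X Y \<longleftrightarrow>
    (\<forall>T :: 'a \<Rightarrow>\<^sub>L 'b. T \<in> sphere 0 1 - linear_isometries \<longrightarrow>
      (\<forall>\<epsilon>>0. \<exists>A. nontrivial_uniform_BPB_approximation \<epsilon> T A \<and>
        norm_attainment_set T = norm_attainment_set A))"

end

theory Submission
  imports Defs
begin

text \<open>
  By compactness of the sphere, it suffices to find operators \<open>A \<noteq> T\<close> of norm 1 arbitrarily close to
  \<open>T\<close> with the same norm attainment set. Identify \<open>T\<close> with the array \<open>r\<close> of its values at four
  vertices of the cube that sum to 0: a 3 by 4 array with zero row sums, the norm of \<open>T\<close> being the
  largest absolute column sum. Moving \<open>r\<close> slightly in a direction \<open>D\<close> with zero row sums preserves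
  the norm attainment set if in each column of absolute sum 1 the direction vanishes where \<open>r\<close> does
  and is orthogonal to the signs of \<open>r\<close>. If a row vanishes, split another row instead. Otherwise
  \<open>D\<close> exists: if all columns have absolute sum 1 and \<open>r\<close> has at most four zeros, there are at most
  \<open>3 + 4 + 4\<close> linear conditions on 12 unknowns, and the remaining zero patterns are so rigid that
  \<open>D\<close> can be written down.
\<close>

section \<open>Norm-preserving directions\<close>

text \<open>
  Only columns of absolute sum 1 are constrained: there the operator attains its norm, and
  elsewhere small changes are harmless.
\<close>

definition column_preserving :: "('i::finite \<Rightarrow> 'j::finite \<Rightarrow> real) \<Rightarrow> ('i \<Rightarrow> 'j \<Rightarrow> real) \<Rightarrow> bool"
  where "column_preserving r D \<longleftrightarrow> (\<forall>i. (\<Sum>j\<in>UNIV. D i j) = 0) \<and>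
    (\<forall>j. (\<Sum>i\<in>UNIV. \<bar>r i j\<bar>) = 1 \<longrightarrow>
      (\<forall>i. r i j = 0 \<longrightarrow> D i j = 0) \<and> (\<Sum>i\<in>UNIV. sgn (r i j) * D i j) = 0)"

lemma sum_two_support:
  fixes f :: "'a::finite \<Rightarrow> real"
  assumes "a \<noteq> b" "\<And>x. x \<noteq> a \<Longrightarrow> x \<noteq> b \<Longrightarrow> f x = 0"
  shows "(\<Sum>x\<in>UNIV. f x) = f a + f b"
proof -
  have "(\<Sum>x\<in>UNIV. f x) = (\<Sum>x\<in>{a, b}. f x)"
    by (rule sum.mono_neutral_right) (use assms in auto)
  then show ?thesis using assms(1) by simp
qed

text \<open>The direction has rank one, \<open>p\<close> times \<open>q\<close>, on two rows and two
  columns. The entries 1 and -1 of \<open>q\<close> make the row sums vanish, and the two weights in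
  \<open>p\<close> cancel against the signs of column \<open>j\<close>. In column \<open>k\<close>
  the same cancellation is what \<open>balanced\<close> provides, and it is demanded only if that
  column is active, that is, of absolute sum 1.\<close>

lemma exists_column_preserving_cycle:
  fixes r :: "'i::finite \<Rightarrow> 'j::finite \<Rightarrow> real"
  assumes "i \<noteq> i'" "j \<noteq> k" "r i j \<noteq> 0" "r i' j \<noteq> 0"
    and balanced: "(\<Sum>a\<in>UNIV. \<bar>r a k\<bar>) = 1 \<Longrightarrow>
      r i k \<noteq> 0 \<and> r i' k \<noteq> 0 \<and> sgn (r i j) * sgn (r i k) = sgn (r i' j) * sgn (r i' k)"
  shows "\<exists>D. column_preserving r D \<and> D \<noteq> (\<lambda>i j. 0)"
proof -
  define p where "p a = (if a = i then sgn (r i j) else if a = i' then - sgn (r i' j) else 0)" for a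
  define q where "q b = (if b = j then 1 else if b = k then -1 else (0::real))" for b
  define D where "D a b = p a * q b" for a b
  have "(\<Sum>b\<in>UNIV. D a b) = 0" for a
    using sum_two_support[OF \<open>j \<noteq> k\<close>, of "D a"] \<open>j \<noteq> k\<close> by (simp add: D_def q_def)
  moreover have "r a b = 0 \<longrightarrow> D a b = 0" if "(\<Sum>i\<in>UNIV. \<bar>r i b\<bar>) = 1" for a b
    using that assms by (auto simp: D_def p_def q_def)
  moreover have "(\<Sum>a\<in>UNIV. sgn (r a b) * D a b) = 0" if "(\<Sum>i\<in>UNIV. \<bar>r i b\<bar>) = 1" for b
  proof -
    have "(\<Sum>a\<in>UNIV. sgn (r a b) * D a b) = sgn (r i b) * D i b + sgn (r i' b) * D i' b"
      by (rule sum_two_support) (use \<open>i \<noteq> i'\<close> in \<open>auto simp: D_def p_def\<close>)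
    also have "\<dots> = (sgn (r i j) * sgn (r i b) - sgn (r i' j) * sgn (r i' b)) * q b"
      using \<open>i \<noteq> i'\<close> by (simp add: D_def p_def algebra_simps)
    also have "\<dots> = 0"
      using that assms by (auto simp: q_def sgn_mult_self_eq)
    finally show ?thesis .
  qed
  moreover have "D i j \<noteq> 0"
    using assms by (simp add: D_def p_def q_def sgn_zero_iff)
  ultimately show ?thesis
    unfolding column_preserving_def by (intro exI[of _ D]) auto
qed

text \<open>Inactive columns carry no constraint, so every row may pass the same amount from one to
  the other.\<close>

lemma exists_column_preserving_two_inactive:
  fixes r :: "'i::finite \<Rightarrow> 'j::finite \<Rightarrow> real"
  assumes "m \<noteq> n" "(\<Sum>i\<in>UNIV. \<bar>r i m\<bar>) \<noteq> 1" "(\<Sum>i\<in>UNIV. \<bar>r i n\<bar>) \<noteq> 1"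
  shows "\<exists>D. column_preserving r D \<and> D \<noteq> (\<lambda>i j. 0)"
proof -
  define D where "D a b = (if b = m then 1 else if b = n then -1 else (0::real))" for a :: 'i and b
  have "(\<Sum>b\<in>UNIV. D a b) = 0" for a
    using sum_two_support[OF assms(1), of "D a"] assms(1) by (simp add: D_def)
  then have "column_preserving r D"
    using assms by (auto simp: column_preserving_def D_def)
  \<comment> \<open>\<open>undefined\<close> serves as an arbitrary row, since \<open>D\<close> does
    not depend on the row.\<close>
  moreover have "D undefined m \<noteq> 0"
    by (simp add: D_def)
  ultimately show ?thesis
    by (intro exI[of _ D]) auto
qed

section \<open>Directions for arrays with three rows and four columns\<close>

lemma UNIV_3_distinct:
  assumes "distinct [a, b, c :: 3]"
  shows "UNIV = {a, b, c}"
  using card_subset_eq[of UNIV "{a, b, c}"] assms by simp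

lemma UNIV_4_distinct:
  assumes "distinct [a, b, c, d :: 4]"
  shows "UNIV = {a, b, c, d}"
  using card_subset_eq[of UNIV "{a, b, c, d}"] assms by simp

lemma mem_3_distinct: "distinct [a, b, c :: 3] \<Longrightarrow> i \<in> {a, b, c}"
  by (metis UNIV_3_distinct UNIV_I)

lemma mem_4_distinct: "distinct [a, b, c, d :: 4] \<Longrightarrow> i \<in> {a, b, c, d}"
  by (metis UNIV_4_distinct UNIV_I)

lemma sum_3_distinct:
  fixes f :: "3 \<Rightarrow> real"
  assumes "distinct [a, b, c]"
  shows "(\<Sum>i\<in>UNIV. f i) = f a + f b + f c"
  using assms by (simp add: UNIV_3_distinct[OF assms])

lemma sum_4_distinct:
  fixes f :: "4 \<Rightarrow> real"
  assumes "distinct [a, b, c, d]"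
  shows "(\<Sum>i\<in>UNIV. f i) = f a + f b + f c + f d"
  using assms by (simp add: UNIV_4_distinct[OF assms])

text \<open>Column \<open>m\<close> can absorb any change. A second inactive column, or an active
  column with two nonzero entries, yields an explicit direction. Otherwise every other column is a
  signed unit vector, which parity excludes.\<close>

lemma exists_column_preserving_inactive:
  fixes r :: "3 \<Rightarrow> 4 \<Rightarrow> real"
  assumes rows: "\<And>i. (\<Sum>j\<in>UNIV. r i j) = 0"
    and cols: "\<And>j. (\<Sum>i\<in>UNIV. \<bar>r i j\<bar>) \<le> 1"
    and m: "(\<Sum>i\<in>UNIV. \<bar>r i m\<bar>) \<noteq> 1"
  shows "\<exists>D. column_preserving r D \<and> D \<noteq> (\<lambda>i j. 0)"
proof (cases "\<exists>n. n \<noteq> m \<and> (\<Sum>i\<in>UNIV. \<bar>r i n\<bar>) \<noteq> 1")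
  case True
  then obtain n where "n \<noteq> m" "(\<Sum>i\<in>UNIV. \<bar>r i n\<bar>) \<noteq> 1" by blast
  then show ?thesis using exists_column_preserving_two_inactive[of n m r] m by blast
next
  case False
  then have active: "(\<Sum>i\<in>UNIV. \<bar>r i j\<bar>) = 1" if "j \<noteq> m" for j
    using that by blast
  show ?thesis
  proof (cases "\<exists>j i i'. j \<noteq> m \<and> i \<noteq> i' \<and> r i j \<noteq> 0 \<and> r i' j \<noteq> 0")
    case True
    then obtain j i i' where "j \<noteq> m" "i \<noteq> i'" "r i j \<noteq> 0" "r i' j \<noteq> 0" by blast
    then show ?thesis using exists_column_preserving_cycle[of i i' j m r] m by blast
  next
    case single: False
    have unit: "\<bar>\<Sum>i\<in>UNIV. r i j\<bar> = 1" if "j \<noteq> m" for j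
    proof -
      obtain i where "\<And>i'. i' \<noteq> i \<Longrightarrow> r i' j = 0"
        using single \<open>j \<noteq> m\<close> by blast
      \<comment> \<open>Column \<open>j\<close> has at most one nonzero entry; \<open>g\<close>
        handles its plain and its absolute sum at once.\<close>
      then have "(\<Sum>i'\<in>UNIV. g (r i' j)) = g (r i j)" if "g 0 = 0" for g :: "real \<Rightarrow> real"
        using that by (subst sum.remove[of _ i]) auto
      from this[of abs] this[of "\<lambda>x. x"] active[OF \<open>j \<noteq> m\<close>] show ?thesis by simp
    qed
    \<comment> \<open>A sum of three signs is odd, so the column sum at \<open>m\<close> could not be less than 1.\<close>
    have "card (UNIV - {m}) = 3" by (simp add: card_Diff_singleton)
    then obtain a b c where abc: "UNIV - {m} = {a, b, c}" "a \<noteq> b" "a \<noteq> c" "b \<noteq> c"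
      unfolding card_3_iff by blast
    then have "a \<noteq> m" "b \<noteq> m" "c \<noteq> m" by blast+
    then have "distinct [a, b, c, m]" using abc by simp
    from sum_4_distinct[OF this, of "\<lambda>j. \<Sum>i\<in>UNIV. r i j"]
    have "(\<Sum>i\<in>UNIV. r i a) + (\<Sum>i\<in>UNIV. r i b) + (\<Sum>i\<in>UNIV. r i c) + (\<Sum>i\<in>UNIV. r i m) = 0"
      by (subst (asm) sum.swap) (simp add: rows)
    with unit[OF \<open>a \<noteq> m\<close>] unit[OF \<open>b \<noteq> m\<close>] unit[OF \<open>c \<noteq> m\<close>]
    have "1 \<le> \<bar>\<Sum>i\<in>UNIV. r i m\<bar>" by linarith
    also have "\<dots> \<le> (\<Sum>i\<in>UNIV. \<bar>r i m\<bar>)" by (rule sum_abs)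
    finally show ?thesis using cols[of m] m by simp
  qed
qed

text \<open>\<open>R\<close>, \<open>C\<close> and \<open>E\<close> represent row sums, signed
  column sums and the entries at zeros of \<open>r\<close> as inner products in dimension 12. At
  most 11 such vectors leave a nonzero \<open>V\<close> orthogonal to all of them, which meets the
  column conditions in every column, active or not.\<close>

lemma exists_column_preserving_few_zeros:
  fixes r :: "3 \<Rightarrow> 4 \<Rightarrow> real"
  assumes "card {(i, j). r i j = 0} \<le> 4"
  shows "\<exists>D. column_preserving r D \<and> D \<noteq> (\<lambda>i j. 0)"
proof -
  define R where "R i = (axis i 1 :: real ^ 4 ^ 3)" for i :: 3
  define C where "C j = ((\<chi> i. axis j (sgn (r i j))) :: real ^ 4 ^ 3)" for j :: 4
  define E where "E = (\<lambda>(i, j). axis i (axis j 1) :: real ^ 4 ^ 3)"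
  let ?Z = "{(i, j). r i j = 0}"
  define B :: "(real ^ 4 ^ 3) set" where "B = range R \<union> range C \<union> E ` ?Z"
  have "card (range R) \<le> 3" "card (range C) \<le> 4" "card (E ` ?Z) \<le> 4"
    using card_image_le[of UNIV R] card_image_le[of UNIV C] card_image_le[of ?Z E] assms by simp_all
  then have "card B \<le> 11"
    using card_Un_le[of "range R" "range C"] card_Un_le[of "range R \<union> range C" "E ` ?Z"]
    unfolding B_def by linarith
  then have "dim B < DIM(real ^ 4 ^ 3)"
    using dim_le_card'[of B] by (simp add: B_def)
  then obtain V where V: "V \<noteq> 0" "\<And>y. y \<in> span B \<Longrightarrow> orthogonal V y"
    using orthogonal_to_subspace_exists by blast
  have orth: "V \<bullet> y = 0" if "y \<in> B" for y
    using V(2)[OF span_base[OF that]] by (simp add: orthogonal_def)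
  have "(\<Sum>j\<in>UNIV. V $ i $ j) = 0" for i
  proof -
    have "V \<bullet> R i = V $ i \<bullet> 1"
      by (simp add: R_def inner_axis)
    also have "\<dots> = (\<Sum>j\<in>UNIV. V $ i $ j)"
      by (simp add: inner_vec_def)
    finally show ?thesis using orth[of "R i"] by (simp add: B_def)
  qed
  moreover have "(\<Sum>i\<in>UNIV. sgn (r i j) * V $ i $ j) = 0" for j
  proof -
    have "V \<bullet> C j = (\<Sum>i\<in>UNIV. sgn (r i j) * V $ i $ j)"
      by (subst inner_vec_def) (simp add: C_def inner_axis mult.commute)
    then show ?thesis using orth[of "C j"] by (simp add: B_def)
  qed
  moreover have "V $ i $ j = 0" if "r i j = 0" for i j
  proof -
    have "V \<bullet> E (i, j) = V $ i $ j"
      by (simp add: E_def inner_axis)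
    then show ?thesis using orth[of "E (i, j)"] that by (auto simp: B_def)
  qed
  moreover have "(\<lambda>i j. V $ i $ j) \<noteq> (\<lambda>i j. 0)"
    using V(1) by (auto simp: vec_eq_iff fun_eq_iff)
  ultimately show ?thesis
    unfolding column_preserving_def by (intro exI[of _ "\<lambda>i j. V $ i $ j"]) auto
qed

lemma sgn_mult_sgn_uminus_self: "r \<noteq> 0 \<Longrightarrow> sgn r * sgn (- r) = (-1::real)"
  by (simp add: sgn_mult[symmetric] sgn_if)

text \<open>The zero of row \<open>i3\<close> at \<open>j1\<close> forces \<open>r i1 j1\<close> to
  be 1 or -1, hence also \<open>r i1 j2\<close>, so row \<open>i3\<close> vanishes at
  \<open>j2\<close> too. Rows \<open>i2\<close> and \<open>i3\<close> are then both supported on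
  \<open>k1\<close>, \<open>k2\<close> with opposite entries, and a cycle on these columns
  works.\<close>

lemma exists_column_preserving_disjoint_rows:
  fixes r :: "3 \<Rightarrow> 4 \<Rightarrow> real"
  assumes rows: "\<And>i. (\<Sum>j\<in>UNIV. r i j) = 0"
    and cols: "\<And>j. (\<Sum>i\<in>UNIV. \<bar>r i j\<bar>) = 1"
    and i: "distinct [i1, i2, i3]" and j: "distinct [j1, j2, k1, k2]"
    and zero: "r i1 k1 = 0" "r i1 k2 = 0" "r i2 j1 = 0" "r i2 j2 = 0"
    and nz: "r i2 k1 \<noteq> 0" "\<exists>j. r i3 j \<noteq> 0" and z3: "r i3 j1 = 0"
  shows "\<exists>D. column_preserving r D \<and> D \<noteq> (\<lambda>i j. 0)"
proof -
  note R = rows[unfolded sum_4_distinct[OF j]] and C = cols[unfolded sum_3_distinct[OF i]]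
  have r1: "r i1 j2 = - r i1 j1" using R[of i1] zero by simp
  have r2: "r i2 k2 = - r i2 k1" using R[of i2] zero by simp
  have z3': "r i3 j2 = 0" using C[of j1] C[of j2] zero z3 r1 by simp
  then have r3: "r i3 k2 = - r i3 k1" using R[of i3] z3 by simp
  obtain l where "r i3 l \<noteq> 0" using nz(2) by blast
  then have "r i3 k1 \<noteq> 0"
    using z3 z3' r3 mem_4_distinct[OF j, of l] by auto
  with nz(1) show ?thesis
    by (intro exists_column_preserving_cycle[of i2 i3 k1 k2])
      (use i j in \<open>auto simp: r2 r3 sgn_mult_sgn_uminus_self\<close>)
qed

text \<open>Here the zero pattern of \<open>r\<close> forces the third row to be \<open>(-b, 0, -a, 1)\<close> up to
  signs, where \<open>a + b = 1\<close>, and \<open>D\<close> is the derivative of this one-parameter family.\<close>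

lemma exists_column_preserving_overlapping_rows:
  fixes r :: "3 \<Rightarrow> 4 \<Rightarrow> real"
  assumes rows: "\<And>i. (\<Sum>j\<in>UNIV. r i j) = 0"
    and cols: "\<And>j. (\<Sum>i\<in>UNIV. \<bar>r i j\<bar>) = 1"
    and i: "distinct [i1, i2, i3]" and j: "distinct [a, b, c, d]"
    and zero: "r i1 b = 0" "r i1 d = 0" "r i2 a = 0" "r i2 d = 0"
    and nz: "r i1 a \<noteq> 0" "r i2 b \<noteq> 0" and z3: "\<exists>j. r i3 j = 0"
  shows "\<exists>D. column_preserving r D \<and> D \<noteq> (\<lambda>i j. 0)"
proof -
  note R = rows[unfolded sum_4_distinct[OF j]] and C = cols[unfolded sum_3_distinct[OF i]]
  have r1: "r i1 c = - r i1 a" using R[of i1] zero by simp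
  have r2: "r i2 c = - r i2 b" using R[of i2] zero by simp
  have ca: "\<bar>r i1 a\<bar> + \<bar>r i3 a\<bar> = 1" and cb: "\<bar>r i2 b\<bar> + \<bar>r i3 b\<bar> = 1"
    and cc: "\<bar>r i1 a\<bar> + \<bar>r i2 b\<bar> + \<bar>r i3 c\<bar> = 1" and cd: "\<bar>r i3 d\<bar> = 1"
    using C[of a] C[of b] C[of c] C[of d] zero r1 r2 by simp_all
  \<comment> \<open>By \<open>cc\<close> the nonzero terms \<open>r i1 a\<close> and
    \<open>r i2 b\<close> have absolute values adding up to at most 1, so neither fills its own
    column alone.\<close>
  have "r i3 a \<noteq> 0" "r i3 b \<noteq> 0" using ca cb cc nz by linarith+
  moreover have "r i3 d \<noteq> 0" using cd by auto
  moreover obtain l where "r i3 l = 0" using z3 by blast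
  ultimately have z: "r i3 c = 0"
    using mem_4_distinct[OF j, of l] by auto
  then have "r i3 a + r i3 b + r i3 d = 0" "\<bar>r i3 a\<bar> + \<bar>r i3 b\<bar> = 1"
    using R[of i3] ca cb cc by simp_all
  \<comment> \<open>The sum of the two entries is \<open>- r i3 d\<close>, of absolute value 1,
    which equals the sum of their absolute values; hence nothing cancels.\<close>
  then have same: "sgn (r i3 a) = sgn (r i3 b)"
    using cd \<open>r i3 a \<noteq> 0\<close> \<open>r i3 b \<noteq> 0\<close> by (auto simp: sgn_if)
  \<comment> \<open>Along \<open>D\<close> the absolute values in row \<open>i1\<close> grow at unit
    rate and those in row \<open>i2\<close> shrink; row \<open>i3\<close> shrinks at
    \<open>a\<close> and grows at \<open>b\<close>. The rates cancel in each column, and row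
    \<open>i3\<close> of \<open>D\<close> sums to 0 because of \<open>same\<close>.\<close>
  define D where "D i j =
    (if i = i1 then (if j = a then sgn (r i1 a) else if j = c then - sgn (r i1 a) else 0)
     else if i = i2 then (if j = b then - sgn (r i2 b) else if j = c then sgn (r i2 b) else 0)
     else (if j = a then - sgn (r i3 a) else if j = b then sgn (r i3 b) else 0))" for i j
  have ij: "i1 \<noteq> i2" "i1 \<noteq> i3" "i2 \<noteq> i3" "a \<noteq> b" "a \<noteq> c" "a \<noteq> d" "b \<noteq> c" "b \<noteq> d" "c \<noteq> d"
    "i2 \<noteq> i1" "i3 \<noteq> i1" "i3 \<noteq> i2" "b \<noteq> a" "c \<noteq> a" "d \<noteq> a" "c \<noteq> b" "d \<noteq> b" "d \<noteq> c"
    using i j by auto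
  have "(\<Sum>j\<in>UNIV. D i j) = 0" for i
    unfolding sum_4_distinct[OF j] by (simp add: D_def ij same)
  moreover have "D i j = 0" if "r i j = 0" for i j
    using that nz r1 r2 \<open>r i3 a \<noteq> 0\<close> \<open>r i3 b \<noteq> 0\<close> mem_3_distinct[OF i, of i]
    by (auto simp: D_def ij)
  moreover have "(\<Sum>i\<in>UNIV. sgn (r i k) * D i k) = 0" for k
  proof -
    have "k \<in> {a, b, c, d}" by (rule mem_4_distinct[OF j])
    then show ?thesis
      unfolding sum_3_distinct[OF i] using nz \<open>r i3 a \<noteq> 0\<close> \<open>r i3 b \<noteq> 0\<close>
      by (auto simp: D_def ij r1 r2 z sgn_mult_self_eq sgn_minus)
  qed
  moreover have "D i1 a \<noteq> 0" using nz by (simp add: D_def sgn_zero_iff)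
  ultimately show ?thesis
    unfolding column_preserving_def by (intro exI[of _ D]) auto
qed

text \<open>A row with two zeros and sum 0 has two opposite nonzero entries. The supports of the two
  sparse rows coincide, giving a cycle, or are disjoint, or share exactly one column; the last two
  cases are the preceding lemmas.\<close>

lemma exists_column_preserving_two_sparse_rows:
  fixes r :: "3 \<Rightarrow> 4 \<Rightarrow> real"
  assumes rows: "\<And>i. (\<Sum>j\<in>UNIV. r i j) = 0"
    and cols: "\<And>j. (\<Sum>i\<in>UNIV. \<bar>r i j\<bar>) = 1"
    and nz: "\<And>i. \<exists>j. r i j \<noteq> 0"
    and i: "distinct [i1, i2, i3]"
    and card: "card {j. r i1 j = 0} = 2" "card {j. r i2 j = 0} = 2" and z3: "\<exists>j. r i3 j = 0"
  shows "\<exists>D. column_preserving r D \<and> D \<noteq> (\<lambda>i j. 0)"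
proof -
  have supp: "\<exists>a b. a \<noteq> b \<and> r i a \<noteq> 0 \<and> r i b = - r i a \<and> (\<forall>j. j \<noteq> a \<longrightarrow> j \<noteq> b \<longrightarrow> r i j = 0)"
    if "card {j. r i j = 0} = 2" for i
  proof -
    have "card {j. r i j \<noteq> 0} = 2"
      using card_Diff_subset[of "{j. r i j = 0}" UNIV] that by (simp add: Collect_neg_eq Compl_eq_Diff_UNIV)
    then obtain a b where ab: "{j. r i j \<noteq> 0} = {a, b}" "a \<noteq> b"
      unfolding card_2_iff by blast
    have "(\<Sum>j\<in>UNIV. r i j) = r i a + r i b"
      by (rule sum_two_support) (use ab in auto)
    then show ?thesis using rows[of i] ab by (intro exI[of _ a] exI[of _ b]) auto
  qed
  obtain a b where ab: "a \<noteq> b" "r i1 a \<noteq> 0" "r i1 b = - r i1 a"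
    "\<And>j. j \<noteq> a \<Longrightarrow> j \<noteq> b \<Longrightarrow> r i1 j = 0"
    using supp[OF card(1)] by blast
  obtain c d where cd: "c \<noteq> d" "r i2 c \<noteq> 0" "r i2 d = - r i2 c"
    "\<And>j. j \<noteq> c \<Longrightarrow> j \<noteq> d \<Longrightarrow> r i2 j = 0"
    using supp[OF card(2)] by blast
  have overlap: ?thesis
    if "x \<noteq> y" "x \<noteq> z" "y \<noteq> z" "r i1 x \<noteq> 0" "r i2 y \<noteq> 0"
      "\<And>j. j \<noteq> x \<Longrightarrow> j \<noteq> z \<Longrightarrow> r i1 j = 0" "\<And>j. j \<noteq> y \<Longrightarrow> j \<noteq> z \<Longrightarrow> r i2 j = 0" for x y z
  proof -
    have "card {x, y, z} = 3" using that by simp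
    then have "{x, y, z} \<noteq> UNIV" by auto
    then obtain w where "w \<notin> {x, y, z}" by blast
    then have "distinct [x, y, z, w]" using that by auto
    from exists_column_preserving_overlapping_rows[OF rows cols i this] show ?thesis
      using that \<open>w \<notin> {x, y, z}\<close> z3 by auto
  qed
  consider "{a, b} = {c, d}" | "{a, b} \<inter> {c, d} = {}" | "a = c" "b \<noteq> d" | "a = d" "b \<noteq> c"
    | "b = c" "a \<noteq> d" | "b = d" "a \<noteq> c"
    by blast
  then show ?thesis
  proof cases
    case 1
    with ab cd have "r i2 a \<noteq> 0" "r i2 b = - r i2 a" by (auto simp: doubleton_eq_iff)
    with ab show ?thesis
      by (intro exists_column_preserving_cycle[of i1 i2 a b])
        (use i in \<open>auto simp: sgn_mult_sgn_uminus_self\<close>)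
  next
    case 2
    then have j: "distinct [a, b, c, d]" using ab cd by auto
    obtain m where "r i3 m = 0" using z3 by blast
    have "m \<in> {a, b, c, d}" by (rule mem_4_distinct[OF j])
    \<comment> \<open>These relabellings bring whichever column holds a zero of the third row into
      the role of \<open>j1\<close>, exchanging the sparse rows if necessary.\<close>
    have j': "distinct [b, a, c, d]" "distinct [c, d, a, b]" "distinct [d, c, a, b]"
      and i': "distinct [i2, i1, i3]"
      using i j by auto
    have z: "r i1 c = 0" "r i1 d = 0" "r i2 a = 0" "r i2 b = 0"
      using ab cd j by auto
    from \<open>m \<in> {a, b, c, d}\<close> \<open>r i3 m = 0\<close>
    have "r i3 a = 0 \<or> r i3 b = 0 \<or> r i3 c = 0 \<or> r i3 d = 0" by auto
    then show ?thesis
      using exists_column_preserving_disjoint_rows[OF rows cols i j]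
        exists_column_preserving_disjoint_rows[OF rows cols i j'(1)]
        exists_column_preserving_disjoint_rows[OF rows cols i' j'(2)]
        exists_column_preserving_disjoint_rows[OF rows cols i' j'(3)] z nz ab(2) cd(2)
      by blast
  next
    case 3
    show ?thesis by (rule overlap[of b d a]) (use 3 ab cd in auto)
  next
    case 4
    show ?thesis by (rule overlap[of b c a]) (use 4 ab cd in auto)
  next
    case 5
    show ?thesis by (rule overlap[of a d b]) (use 5 ab cd in auto)
  next
    case 6
    show ?thesis by (rule overlap[of a c b]) (use 6 ab cd in auto)
  qed
qed

text \<open>A nonzero row of sum 0 has at least two nonzero entries, hence at most two zeros. So
  more than four zeros are distributed over the rows as 2, 2, 1 or 2, 2, 2, and two rows are
  sparse.\<close>

lemma exists_column_preserving:
  fixes r :: "3 \<Rightarrow> 4 \<Rightarrow> real"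
  assumes rows: "\<And>i. (\<Sum>j\<in>UNIV. r i j) = 0"
    and cols: "\<And>j. (\<Sum>i\<in>UNIV. \<bar>r i j\<bar>) \<le> 1"
    and nz: "\<And>i. \<exists>j. r i j \<noteq> 0"
  shows "\<exists>D. column_preserving r D \<and> D \<noteq> (\<lambda>i j. 0)"
proof (cases "\<forall>j. (\<Sum>i\<in>UNIV. \<bar>r i j\<bar>) = 1")
  case False
  then show ?thesis using exists_column_preserving_inactive[OF rows cols] by blast
next
  case True
  define z where "z i = card {j. r i j = 0}" for i
  have z_le: "z i \<le> 2" for i
  proof -
    obtain j where j: "r i j \<noteq> 0" using nz by blast
    have "\<exists>k. k \<noteq> j \<and> r i k \<noteq> 0"
    proof (rule ccontr)
      assume "\<not> ?thesis"
      then have "(\<Sum>k\<in>UNIV. r i k) = (\<Sum>k\<in>{j}. r i k)"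
        by (intro sum.mono_neutral_right) auto
      then show False using rows[of i] j by simp
    qed
    then obtain k where "k \<noteq> j" "r i k \<noteq> 0" by blast
    with j have "{j. r i j = 0} \<subseteq> - {j, k}" by auto
    then have "z i \<le> card (- {j, k})" unfolding z_def by (intro card_mono) auto
    also have "\<dots> = 2" using \<open>k \<noteq> j\<close> by (simp add: Compl_eq_Diff_UNIV card_Diff_subset)
    finally show ?thesis .
  qed
  have z_pos: "\<exists>j. r i j = 0" if "z i \<ge> 1" for i
  proof (rule ccontr)
    assume "\<not> ?thesis"
    then show False using that by (simp add: z_def)
  qed
  have "{(i, j). r i j = 0} = (SIGMA i:UNIV. {j. r i j = 0})" by auto
  then have "card {(i, j). r i j = 0} = z 1 + z 2 + z 3"
    by (simp add: z_def card_SigmaI sum_3)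
  then consider "card {(i, j). r i j = 0} \<le> 4" | "z 1 = 2" "z 2 = 2" "z 3 \<ge> 1"
    | "z 1 = 2" "z 3 = 2" "z 2 \<ge> 1" | "z 2 = 2" "z 3 = 2" "z 1 \<ge> 1"
    using z_le[of 1] z_le[of 2] z_le[of 3] by linarith
  then show ?thesis
  proof cases
    case 1
    then show ?thesis by (rule exists_column_preserving_few_zeros)
  next
    case 2
    show ?thesis
      by (rule exists_column_preserving_two_sparse_rows[of r 1 2 3])
        (use rows True nz 2 z_pos in \<open>auto simp: z_def\<close>)
  next
    case 3
    show ?thesis
      by (rule exists_column_preserving_two_sparse_rows[of r 1 3 2])
        (use rows True nz 3 z_pos in \<open>auto simp: z_def\<close>)
  next
    case 4
    show ?thesis
      by (rule exists_column_preserving_two_sparse_rows[of r 2 3 1])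
        (use rows True nz 4 z_pos in \<open>auto simp: z_def\<close>)
  qed
qed

section \<open>Operators as matrices\<close>

lemma bounded_linear_linf_vec: "bounded_linear (linf_vec :: 'n::finite linf \<Rightarrow> real ^ 'n)"
proof (rule bounded_linear_intro)
  show "norm (linf_vec x) \<le> norm x * sqrt DIM(real ^ 'n)" for x :: "'n linf"
    using norm_le_infnorm[of "linf_vec x"] by (simp add: norm_linf.rep_eq mult.commute)
qed (simp_all add: plus_linf.rep_eq scaleR_linf.rep_eq)

lemma bounded_linear_linf_of_vec: "bounded_linear (linf_of_vec :: real ^ 'n::finite \<Rightarrow> 'n linf)"
proof (rule bounded_linear_intro)
  show "norm (linf_of_vec v) \<le> norm v * 1" for v :: "real ^ 'n"
    by (simp add: norm_linf.rep_eq linf_of_vec_inverse infnorm_le_norm)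
qed (simp_all add: linf_vec_inject[symmetric] plus_linf.rep_eq scaleR_linf.rep_eq linf_of_vec_inverse)

lemma bounded_linear_l1_vec: "bounded_linear (l1_vec :: 'n::finite l1 \<Rightarrow> real ^ 'n)"
proof (rule bounded_linear_intro)
  show "norm (l1_vec x) \<le> norm x * 1" for x :: "'n l1"
    using norm_le_l1_cart[of "l1_vec x"] by (simp add: norm_l1.rep_eq)
qed (simp_all add: plus_l1.rep_eq scaleR_l1.rep_eq)

lemma bounded_linear_l1_of_vec: "bounded_linear (l1_of_vec :: real ^ 'n::finite \<Rightarrow> 'n l1)"
proof (rule bounded_linear_intro)
  show "norm (l1_of_vec v) \<le> norm v * real CARD('n)" for v :: "real ^ 'n"
    using sum_bounded_above[of UNIV "\<lambda>i. \<bar>v $ i\<bar>" "norm v"]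
    by (simp add: norm_l1.rep_eq l1_of_vec_inverse component_le_norm_cart mult.commute)
qed (simp_all add: l1_vec_inject[symmetric] plus_l1.rep_eq scaleR_l1.rep_eq l1_of_vec_inverse)

section \<open>Compactness and the uniform gap\<close>

lemma compact_sphere_linf: "compact (sphere 0 1 :: 'n::finite linf set)"
proof -
  let ?S = "{v :: real ^ 'n. infnorm v = 1}"
  have "closed ?S"
    by (intro closed_Collect_eq continuous_intros continuous_on_infnorm) 
  moreover have "bounded ?S"
    unfolding bounded_iff using norm_le_infnorm[where 'a = "real ^ 'n"]
    by (metis mem_Collect_eq mult.right_neutral)
  ultimately have "compact ?S"
    by (simp add: compact_eq_bounded_closed)
  then have "compact (linf_of_vec ` ?S)"
    by (intro compact_continuous_image linear_continuous_on bounded_linear_linf_of_vec)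
  moreover have "linf_of_vec ` ?S = sphere 0 1"
    by (auto simp: norm_linf.rep_eq linf_of_vec_inverse image_iff) (metis linf_vec_inverse)
  ultimately show ?thesis by simp
qed

text \<open>Where \<open>\<parallel>T x\<parallel> < \<parallel>T\<parallel>\<close> on a compact set, the gap is uniform.\<close>

lemma uniform_BPB_approximation_of_attainment_eq:
  fixes T A :: "'a::real_normed_vector \<Rightarrow>\<^sub>L 'b::real_normed_vector"
  assumes "compact (sphere 0 1 :: 'a set)"
    and "norm T = 1" "norm A = 1" "norm (T - A) < \<epsilon>" "\<epsilon> > 0"
    and eq: "norm_attainment_set T = norm_attainment_set A"
  shows "uniform_BPB_approximation \<epsilon> T A"
proof -
  \<comment> \<open>\<open>K\<close> holds the unit vectors at distance at least
    \<open>\<epsilon>\<close> from every point where \<open>A\<close> attains its norm. It misses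
    the attainment set of \<open>T\<close>, and a suitable \<open>\<delta>\<close> is the gap
    between 1 and the maximum of \<open>norm (T x)\<close> on \<open>K\<close>.\<close>
  define K where "K = sphere 0 1 - (\<Union>u\<in>norm_attainment_set A. ball u \<epsilon>)"
  have "compact K"
    unfolding K_def using assms(1) by (intro compact_diff) auto
  have less: "norm (T x) < 1" if "x \<in> K" for x
  proof -
    have "x \<notin> norm_attainment_set T"
      using that \<open>\<epsilon> > 0\<close> unfolding K_def eq by auto
    moreover have "norm (T x) \<le> 1"
      using norm_blinfun[of T x] that \<open>norm T = 1\<close> by (simp add: K_def)
    ultimately show ?thesis
      using that \<open>norm T = 1\<close> by (auto simp: norm_attainment_set_def K_def)
  qed
  have "\<exists>\<delta>>0. \<forall>x\<in>K. norm (T x) \<le> 1 - \<delta>"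
  proof (cases "K = {}")
    case True
    then show ?thesis by (intro exI[of _ 1]) simp
  next
    case False
    have "continuous_on K (\<lambda>x. norm (T x))"
      by (intro continuous_intros)
    from continuous_attains_sup[OF \<open>compact K\<close> False this]
    obtain z where "z \<in> K" "\<And>x. x \<in> K \<Longrightarrow> norm (T x) \<le> norm (T z)" by blast
    with less[of z] show ?thesis by (intro exI[of _ "1 - norm (T z)"]) auto
  qed
  then obtain \<delta> where \<delta>: "\<delta> > 0" "\<And>x. x \<in> K \<Longrightarrow> norm (T x) \<le> 1 - \<delta>" by blast
  have "\<exists>u\<in>norm_attainment_set A. norm (u - x) < \<epsilon>"
    if "x \<in> sphere 0 1" "norm (T x) > 1 - \<delta>" for x
  proof -
    have "x \<notin> K" using \<delta>(2)[of x] that(2) by auto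
    with that(1) show ?thesis by (auto simp: K_def dist_norm)
  qed
  with \<delta>(1) assms show ?thesis
    by (auto simp: uniform_BPB_approximation_def)
qed

section \<open>The correspondence between matrices and operators\<close>

definition matrix_blinfun :: "real ^ 'n::finite ^ 'm::finite \<Rightarrow> 'n linf \<Rightarrow>\<^sub>L 'm l1"
  where "matrix_blinfun M = Blinfun (\<lambda>x. l1_of_vec (M *v linf_vec x))"

lemma matrix_blinfun_apply: "matrix_blinfun M x = l1_of_vec (M *v linf_vec x)"
  unfolding matrix_blinfun_def
  by (subst bounded_linear_Blinfun_apply) (intro bounded_linear_compose[OF bounded_linear_l1_of_vec]
      bounded_linear_compose[OF matrix_vector_mul_bounded_linear] bounded_linear_linf_vec refl)+

lemma norm_matrix_blinfun_apply: "norm (matrix_blinfun M x) = (\<Sum>i\<in>UNIV. \<bar>M $ i \<bullet> linf_vec x\<bar>)"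
  by (simp add: matrix_blinfun_apply norm_l1.rep_eq l1_of_vec_inverse matrix_vector_mul_component)

lemma matrix_blinfun_add_scaleR:
  "matrix_blinfun (M + h *\<^sub>R S) = matrix_blinfun M + h *\<^sub>R matrix_blinfun S"
  by (rule blinfun_eqI)
    (simp add: matrix_blinfun_apply blinfun.add_left blinfun.scaleR_left l1_vec_inject[symmetric]
      plus_l1.rep_eq scaleR_l1.rep_eq l1_of_vec_inverse matrix_vector_mult_add_rdistrib
      scaleR_matrix_vector_assoc)

lemma matrix_blinfun_inject: "matrix_blinfun M = matrix_blinfun N \<longleftrightarrow> M = N"
proof
  assume eq: "matrix_blinfun M = matrix_blinfun N"
  have "M *v v = N *v v" for v
    using arg_cong[OF eq, of "\<lambda>A. l1_vec (A (linf_of_vec v))"]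
    by (simp add: matrix_blinfun_apply l1_of_vec_inverse linf_of_vec_inverse)
  then show "M = N" by (simp add: matrix_eq)
qed simp

lemma matrix_blinfun_surj: "\<exists>M. T = matrix_blinfun M"
proof -
  have "linear (\<lambda>v. l1_vec (T (linf_of_vec v)))"
    by (intro bounded_linear.linear bounded_linear_compose[OF bounded_linear_l1_vec]
        bounded_linear_compose[OF blinfun.bounded_linear_right] bounded_linear_linf_of_vec)
  then have "T = matrix_blinfun (matrix (\<lambda>v. l1_vec (T (linf_of_vec v))))"
    by (intro blinfun_eqI) (simp add: matrix_blinfun_apply matrix_works linf_vec_inverse l1_vec_inverse)
  then show ?thesis by blast
qed

text \<open>The map taking \<open>y\<close> to \<open>-1 + 2 *\<^sub>R y\<close> carries the unit
  cube, the hull of the 0-1 vectors, onto the cube of sign vectors.\<close>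

lemma mem_cube_convex_hull:
  fixes x :: "real ^ 'n::finite"
  assumes "infnorm x \<le> 1"
  shows "x \<in> convex hull {v. \<forall>k. \<bar>v $ k\<bar> = 1}"
proof -
  define y where "y = (1/2) *\<^sub>R (x + 1)"
  have "\<bar>x $ k\<bar> \<le> 1" for k
    using component_le_infnorm_cart[of x k] assms by linarith
  then have "y \<in> cbox 0 1"
    unfolding mem_box_cart y_def by (auto simp: abs_le_iff) (smt (verit))+
  moreover have "{v :: real ^ 'n. \<forall>b\<in>Basis. v \<bullet> b = 0 \<or> v \<bullet> b = 1} = {v. \<forall>k. v $ k = 0 \<or> v $ k = 1}"
    by (simp add: Basis_vec_def inner_axis)
  ultimately have "y \<in> convex hull {v. \<forall>k. v $ k = 0 \<or> v $ k = 1}"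
    using unit_interval_convex_hull[where 'a = "real ^ 'n"] by (simp only: Cart_1)
  moreover have "x = -1 + 2 *\<^sub>R y" by (simp add: y_def)
  ultimately have "x \<in> convex hull ((\<lambda>v. -1 + 2 *\<^sub>R v) ` {v. \<forall>k. v $ k = 0 \<or> v $ k = 1})"
    unfolding convex_hull_affinity by blast
  also have "\<dots> \<subseteq> convex hull {v. \<forall>k. \<bar>v $ k\<bar> = 1}"
    by (rule hull_mono) (auto, smt (verit))
  finally show ?thesis .
qed

text \<open>An average of values at most 1 equals 1 only if every vertex of positive weight has
  value 1. Thus \<open>x\<close> lies in the face cut out by \<open>u\<close>, and there
  \<open>u'\<close> is 1 as well.\<close>

lemma inner_eq_1_on_convex_hull:
  fixes x u u' :: "'a::real_inner"
  assumes "finite V" "x \<in> convex hull V" "\<And>v. v \<in> V \<Longrightarrow> u \<bullet> v \<le> 1"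
    and "\<And>v. v \<in> V \<Longrightarrow> u \<bullet> v = 1 \<Longrightarrow> u' \<bullet> v = 1" and "u \<bullet> x = 1"
  shows "u' \<bullet> x = 1"
proof -
  obtain c where c: "\<And>v. v \<in> V \<Longrightarrow> 0 \<le> c v" "sum c V = 1" "(\<Sum>v\<in>V. c v *\<^sub>R v) = x"
    using assms(2) unfolding convex_hull_finite[OF assms(1)] by blast
  \<comment> \<open>The gap at \<open>x\<close> is the weighted average of the gaps at the vertices,
    for any functional \<open>t\<close>.\<close>
  have split: "(\<Sum>v\<in>V. c v * (1 - t \<bullet> v)) = 1 - t \<bullet> x" for t
    unfolding c(3)[symmetric] by (simp add: algebra_simps sum_subtractf c(2) inner_sum_right)
  have "(\<Sum>v\<in>V. c v * (1 - u \<bullet> v)) = 0" using split[of u] assms(5) by simp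
  then have "\<forall>v\<in>V. c v * (1 - u \<bullet> v) = 0"
    using c(1) assms(1,3) by (subst (asm) sum_nonneg_eq_0_iff) auto
  then have "(\<Sum>v\<in>V. c v * (1 - u' \<bullet> v)) = 0" using assms(4) by (intro sum.neutral) auto
  then show ?thesis using split[of u'] by simp
qed

section \<open>Vertices of the cube\<close>

text \<open>One vertex of the cube \<open>[-1, 1]^3\<close> from each antipodal pair, chosen so that they sum to 0.\<close>

definition cube_vertex :: "4 \<Rightarrow> real ^ 3"
  where "cube_vertex j = vector
    (if j = 1 then [1, 1, 1] else if j = 2 then [1, -1, -1] else if j = 3 then [-1, 1, -1]
     else [-1, -1, 1])"

lemma sum_cube_vertex: "(\<Sum>j\<in>UNIV. cube_vertex j) = 0"
  by (simp add: vec_eq_iff forall_3 sum_4 cube_vertex_def)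

lemma inner_cube_vertex: "cube_vertex j \<bullet> cube_vertex k = (if j = k then 3 else -1)"
proof -
  have "\<forall>j k. cube_vertex j \<bullet> cube_vertex k = (if j = k then 3 else -1)"
    by (simp add: forall_4 inner_vec_def sum_3 cube_vertex_def)
  then show ?thesis by blast
qed

lemma abs_cube_vertex: "\<bar>cube_vertex j $ k\<bar> = 1"
proof -
  have "\<forall>j k. \<bar>cube_vertex j $ k\<bar> = 1"
    by (simp add: forall_4 forall_3 cube_vertex_def)
  then show ?thesis by blast
qed

lemma sign_vector_eq_cube_vertex:
  fixes v :: "real ^ 3"
  assumes "\<forall>k. \<bar>v $ k\<bar> = 1"
  shows "\<exists>\<sigma> j. \<bar>\<sigma>\<bar> = 1 \<and> v = \<sigma> *\<^sub>R cube_vertex j"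
proof -
  have v: "v $ 1 = 1 \<or> v $ 1 = -1" "v $ 2 = 1 \<or> v $ 2 = -1" "v $ 3 = 1 \<or> v $ 3 = -1"
    using assms by (auto simp: forall_3 abs_if split: if_splits)
  \<comment> \<open>\<open>j\<close> is 1 if all coordinates agree; otherwise it records which
    coordinate differs from the other two. The factor \<open>\<sigma>\<close> then compares first
    coordinates.\<close>
  define j :: 4 where "j = (if v $ 2 = v $ 3 then (if v $ 1 = v $ 2 then 1 else 2)
    else if v $ 1 = v $ 3 then 3 else 4)"
  define \<sigma> where "\<sigma> = v $ 1 * cube_vertex j $ 1"
  have "v = \<sigma> *\<^sub>R cube_vertex j"
    using v by (auto simp: vec_eq_iff forall_3 \<sigma>_def j_def cube_vertex_def)
  moreover have "\<bar>\<sigma>\<bar> = 1"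
    using assms by (simp add: \<sigma>_def abs_mult abs_cube_vertex)
  ultimately show ?thesis by blast
qed

lemma norm_linf_of_vec_cube_vertex: "norm (linf_of_vec (cube_vertex j)) = 1"
  by (simp add: norm_linf_eq_Max linf_of_vec_inverse abs_cube_vertex)

lemma inner_all_cube_vertex_eq_0:
  assumes "\<And>j. x \<bullet> cube_vertex j = 0"
  shows "x = 0"
proof -
  have "\<forall>j. x \<bullet> cube_vertex j = 0" using assms by blast
  then have "\<forall>k. x $ k = 0"
    unfolding forall_4 forall_3 by (simp add: inner_vec_def sum_3 cube_vertex_def)
  then show ?thesis by (simp add: vec_eq_iff)
qed

lemma finite_sign_vectors: "finite {v :: real ^ 3. \<forall>k. \<bar>v $ k\<bar> = 1}"
proof (rule finite_subset)
  show "{v :: real ^ 3. \<forall>k. \<bar>v $ k\<bar> = 1} \<subseteq> cube_vertex ` UNIV \<union> uminus ` cube_vertex ` UNIV"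
    using sign_vector_eq_cube_vertex by (fastforce simp: abs_if split: if_splits)
qed simp

text \<open>With \<open>exists_sum_sign_inner_eq\<close>, this writes the sum norm of an image as a
  maximum of linear functionals over sign choices, which opens it to convexity arguments on the
  cube.\<close>

lemma sum_sign_inner_le:
  fixes M :: "real ^ 'n::finite ^ 'm::finite"
  assumes "\<And>i. \<bar>s i\<bar> = 1"
  shows "(\<Sum>i\<in>UNIV. s i *\<^sub>R M $ i) \<bullet> v \<le> (\<Sum>i\<in>UNIV. \<bar>M $ i \<bullet> v\<bar>)"
proof -
  have "s i * (M $ i \<bullet> v) \<le> \<bar>M $ i \<bullet> v\<bar>" for i
    using abs_ge_self[of "s i * (M $ i \<bullet> v)"] assms[of i] by (simp add: abs_mult)
  then show ?thesis by (simp add: inner_sum_left sum_mono)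
qed

lemma exists_sum_sign_inner_eq:
  fixes M :: "real ^ 'n::finite ^ 'm::finite"
  shows "\<exists>s. (\<forall>i. \<bar>s i\<bar> = 1) \<and> (\<Sum>i\<in>UNIV. s i *\<^sub>R M $ i) \<bullet> v = (\<Sum>i\<in>UNIV. \<bar>M $ i \<bullet> v\<bar>)"
  by (rule exI[of _ "\<lambda>i. if M $ i \<bullet> v \<ge> 0 then 1 else -1"])
    (auto simp: inner_sum_left intro!: sum.cong)

definition vertex_values :: "real ^ 3 ^ 3 \<Rightarrow> 3 \<Rightarrow> 4 \<Rightarrow> real"
  where "vertex_values M i j = M $ i \<bullet> cube_vertex j"

lemma norm_matrix_blinfun_cube_vertex:
  "norm (matrix_blinfun M (linf_of_vec (cube_vertex j))) = (\<Sum>i\<in>UNIV. \<bar>vertex_values M i j\<bar>)"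
  by (simp add: norm_matrix_blinfun_apply linf_of_vec_inverse vertex_values_def)

lemma vertex_values_sum_le_norm:
  "(\<Sum>i\<in>UNIV. \<bar>vertex_values M i j\<bar>) \<le> norm (matrix_blinfun M)"
  using norm_blinfun[of "matrix_blinfun M" "linf_of_vec (cube_vertex j)"]
  by (simp add: norm_matrix_blinfun_cube_vertex norm_linf_of_vec_cube_vertex)

lemma sum_vertex_values: "(\<Sum>j\<in>UNIV. vertex_values M i j) = 0"
  by (simp add: vertex_values_def inner_sum_right[symmetric] sum_cube_vertex)

text \<open>The sum is even in \<open>v\<close>, so one vertex from each antipodal pair controls all
  eight.\<close>

lemma sum_abs_inner_sign_vector_le:
  assumes "\<And>j. (\<Sum>i\<in>UNIV. \<bar>vertex_values M i j\<bar>) \<le> c" "\<forall>k. \<bar>v $ k\<bar> = 1"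
  shows "(\<Sum>i\<in>UNIV. \<bar>M $ i \<bullet> v\<bar>) \<le> c"
proof -
  obtain \<sigma> j where "\<bar>\<sigma>\<bar> = 1" "v = \<sigma> *\<^sub>R cube_vertex j"
    using sign_vector_eq_cube_vertex assms(2) by blast
  then show ?thesis using assms(1)[of j] by (simp add: vertex_values_def abs_mult)
qed

text \<open>For fixed \<open>y\<close> the norm of the image is the value of one signed functional.
  That functional is at most \<open>c\<close> at the sign vectors, hence on their convex hull, which
  contains the unit ball.\<close>

lemma norm_matrix_blinfun_le:
  assumes le: "\<And>j. (\<Sum>i\<in>UNIV. \<bar>vertex_values M i j\<bar>) \<le> c"
  shows "norm (matrix_blinfun M) \<le> c"
proof (rule norm_blinfun_bound)
  show "0 \<le> c" using order_trans[OF sum_nonneg le] by simp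
  fix x :: "3 linf"
  have unit: "norm (matrix_blinfun M y) \<le> c" if "norm y \<le> 1" for y
  proof -
    obtain s where s: "\<forall>i. \<bar>s i\<bar> = 1"
      "(\<Sum>i\<in>UNIV. s i *\<^sub>R M $ i) \<bullet> linf_vec y = norm (matrix_blinfun M y)"
      using exists_sum_sign_inner_eq[of M "linf_vec y"] by (auto simp: norm_matrix_blinfun_apply)
    have "convex hull {v. \<forall>k. \<bar>v $ k\<bar> = 1} \<subseteq> {v. (\<Sum>i\<in>UNIV. s i *\<^sub>R M $ i) \<bullet> v \<le> c}"
      using order_trans[OF sum_sign_inner_le sum_abs_inner_sign_vector_le[OF le]] s(1)
      by (intro hull_minimal convex_halfspace_le) blast
    with mem_cube_convex_hull[of "linf_vec y"] that show ?thesis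
      by (auto simp: norm_linf.rep_eq s(2))
  qed
  show "norm (matrix_blinfun M x) \<le> c * norm x"
  proof (cases "x = 0")
    case False
    with unit[of "(1 / norm x) *\<^sub>R x"] show ?thesis
      by (simp add: blinfun.scaleR_right field_simps)
  qed simp
qed

text \<open>Equality of the signed and the absolute sum forces \<open>s i\<close> to be the sign of
  \<open>r i j\<close> wherever that entry is nonzero. At zero entries \<open>s i\<close> is
  undetermined, but there \<open>D\<close> vanishes.\<close>

lemma column_preserving_sign:
  assumes "column_preserving r D" "(\<Sum>i\<in>UNIV. \<bar>r i j\<bar>) = 1"
    and s: "\<And>i. \<bar>s i\<bar> = 1" and "(\<Sum>i\<in>UNIV. s i * r i j) = 1"
  shows "(\<Sum>i\<in>UNIV. s i * D i j) = 0"
proof -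
  have nonneg: "0 \<le> \<bar>r i j\<bar> - s i * r i j" for i
    using abs_ge_self[of "s i * r i j"] s[of i] by (simp add: abs_mult)
  have "(\<Sum>i\<in>UNIV. \<bar>r i j\<bar> - s i * r i j) = 0"
    by (simp add: sum_subtractf assms)
  then have eq: "\<bar>r i j\<bar> = s i * r i j" for i
    using nonneg by (subst (asm) sum_nonneg_eq_0_iff) auto
  have "s i * D i j = sgn (r i j) * D i j" for i
  proof (cases "r i j = 0")
    case True
    then show ?thesis using assms(1,2) by (simp add: column_preserving_def)
  next
    case False
    with eq[of i] s[of i] have "s i = sgn (r i j)" by (auto simp: sgn_if abs_if split: if_splits)
    then show ?thesis by simp
  qed
  then have "(\<Sum>i\<in>UNIV. s i * D i j) = (\<Sum>i\<in>UNIV. sgn (r i j) * D i j)" by (intro sum.cong) auto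
  then show ?thesis using assms(1,2) by (simp add: column_preserving_def)
qed

text \<open>Signs \<open>s\<close> realising the norm at \<open>x\<close> define a functional that
  is 1 on a face of the cube containing \<open>x\<close>. The vertices of this face belong to active
  columns, where \<open>D\<close> contributes 0, so the functional of \<open>N\<close> with the same
  signs is still 1 at \<open>x\<close>.\<close>

lemma norm_ge_1_of_column_preserving:
  assumes M: "\<And>j. (\<Sum>i\<in>UNIV. \<bar>vertex_values M i j\<bar>) \<le> 1"
    and D: "column_preserving (vertex_values M) D"
    and N: "\<And>i j. vertex_values N i j = vertex_values M i j + D i j"
    and x: "norm x = 1" "norm (matrix_blinfun M x) = 1"
  shows "norm (matrix_blinfun N x) \<ge> 1"
proof -
  let ?V = "{v :: real ^ 3. \<forall>k. \<bar>v $ k\<bar> = 1}"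
  obtain s where s: "\<And>i. \<bar>s i\<bar> = 1"
    and sx: "(\<Sum>i\<in>UNIV. s i *\<^sub>R M $ i) \<bullet> linf_vec x = 1"
    using exists_sum_sign_inner_eq[of M "linf_vec x"] x(2)
    by (auto simp: norm_matrix_blinfun_apply)
  have "(\<Sum>i\<in>UNIV. s i *\<^sub>R N $ i) \<bullet> linf_vec x = 1"
  proof (rule inner_eq_1_on_convex_hull[OF finite_sign_vectors])
    show "linf_vec x \<in> convex hull ?V"
      using mem_cube_convex_hull[of "linf_vec x"] x(1) by (simp add: norm_linf.rep_eq)
    show "(\<Sum>i\<in>UNIV. s i *\<^sub>R M $ i) \<bullet> v \<le> 1" if "v \<in> ?V" for v
      using order_trans[OF sum_sign_inner_le sum_abs_inner_sign_vector_le[OF M]] s that by blast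
    show "(\<Sum>i\<in>UNIV. s i *\<^sub>R N $ i) \<bullet> v = 1"
      if "v \<in> ?V" and eq: "(\<Sum>i\<in>UNIV. s i *\<^sub>R M $ i) \<bullet> v = 1" for v
    proof -
      obtain \<sigma> j where \<sigma>: "\<bar>\<sigma>\<bar> = 1" "v = \<sigma> *\<^sub>R cube_vertex j"
        using sign_vector_eq_cube_vertex \<open>v \<in> ?V\<close> by blast
      \<comment> \<open>The antipodal sign \<open>\<sigma>\<close> is absorbed into the row signs,
        reducing \<open>v\<close> to column \<open>j\<close>.\<close>
      define t where "t i = \<sigma> * s i" for i
      have t: "\<bar>t i\<bar> = 1" for i by (simp add: t_def abs_mult \<sigma> s)
      have tP: "(\<Sum>i\<in>UNIV. s i *\<^sub>R P $ i) \<bullet> v = (\<Sum>i\<in>UNIV. t i * vertex_values P i j)" for P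
        by (simp add: inner_sum_left \<sigma>(2) t_def vertex_values_def sum_distrib_left ac_simps)
      have 1: "(\<Sum>i\<in>UNIV. t i * vertex_values M i j) = 1" using eq tP by simp
      have "(\<Sum>i\<in>UNIV. t i * vertex_values M i j) \<le> (\<Sum>i\<in>UNIV. \<bar>vertex_values M i j\<bar>)"
      proof (rule sum_mono)
        show "t i * vertex_values M i j \<le> \<bar>vertex_values M i j\<bar>" for i
          using abs_ge_self[of "t i * vertex_values M i j"] t[of i] by (simp add: abs_mult)
      qed
      with 1 have "(\<Sum>i\<in>UNIV. \<bar>vertex_values M i j\<bar>) = 1" using M[of j] by simp
      from column_preserving_sign[OF D this t 1] 1 show ?thesis
        by (simp add: tP N distrib_left sum.distrib)
    qed
    show "(\<Sum>i\<in>UNIV. s i *\<^sub>R M $ i) \<bullet> linf_vec x = 1" by (rule sx)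
  qed
  with sum_sign_inner_le[of s N "linf_vec x"] s show ?thesis
    by (simp add: norm_matrix_blinfun_apply)
qed

section \<open>Perturbations\<close>

text \<open>The Gram matrix of the vertices is 4 times the identity minus the all-ones matrix. The
  latter kills zero row sums, so a quarter of the combination of the vertices inverts
  \<open>vertex_values\<close>.\<close>

lemma exists_matrix_vertex_values:
  assumes "\<And>i. (\<Sum>j\<in>UNIV. D i j) = 0"
  shows "\<exists>S. vertex_values S = D"
proof -
  define S :: "real ^ 3 ^ 3" where "S = (\<chi> i. (1/4) *\<^sub>R (\<Sum>j\<in>UNIV. D i j *\<^sub>R cube_vertex j))"
  have "vertex_values S i k = D i k" for i k
  proof -
    have "(\<Sum>j\<in>UNIV. D i j * (cube_vertex j \<bullet> cube_vertex k)) =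
        (\<Sum>j\<in>UNIV. (if j = k then 4 * D i j else 0) - D i j)"
      by (rule sum.cong) (simp_all add: inner_cube_vertex)
    also have "\<dots> = 4 * D i k"
      by (simp add: sum_subtractf assms)
    finally show ?thesis
      by (simp add: vertex_values_def S_def inner_sum_left)
  qed
  then show ?thesis by (intro exI[of _ S] ext)
qed

lemma norm_attainment_set_eqI:
  fixes T A :: "'a::real_normed_vector \<Rightarrow>\<^sub>L 'b::real_normed_vector"
  assumes "norm T = 1" "norm A = 1"
    and "\<And>x. norm x = 1 \<Longrightarrow> norm (T x) = 1 \<Longrightarrow> 1 \<le> norm (A x)"
    and "\<And>x. norm x = 1 \<Longrightarrow> norm (A x) = 1 \<Longrightarrow> 1 \<le> norm (T x)"
  shows "norm_attainment_set T = norm_attainment_set A"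
proof -
  have "norm (T x) \<le> 1" "norm (A x) \<le> 1" if "norm x = 1" for x
    using norm_blinfun[of T x] norm_blinfun[of A x] that assms(1,2) by simp_all
  then show ?thesis
    using assms by (auto simp: norm_attainment_set_def intro: antisym)
qed

lemma eventually_small_perturbation:
  fixes T S :: "'a::real_normed_vector \<Rightarrow>\<^sub>L 'b::real_normed_vector"
  assumes "\<epsilon> > 0"
  shows "\<forall>\<^sub>F h in at_right 0. norm (T - (T + h *\<^sub>R S)) < \<epsilon>"
proof -
  have "((\<lambda>h. norm (T - (T + h *\<^sub>R S))) \<longlongrightarrow> norm (T - (T + 0 *\<^sub>R S))) (at_right 0)"
    by (intro tendsto_intros)
  from order_tendstoD(2)[OF this] show ?thesis using assms by simp
qed

text \<open>For small \<open>h > 0\<close>, \<open>N\<close> keeps active columns active and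
  inactive ones inactive. One inclusion of attainment sets comes from moving \<open>M\<close> along
  \<open>h\<close> times \<open>D\<close>, the other from moving \<open>N\<close> back along
  \<open>- h\<close> times \<open>D\<close>.\<close>

lemma exists_approximation_of_column_preserving:
  fixes M :: "real ^ 3 ^ 3"
  assumes norm: "norm (matrix_blinfun M) = 1" and "\<epsilon> > 0"
    and D: "column_preserving (vertex_values M) D" "D \<noteq> (\<lambda>i j. 0)"
  shows "\<exists>A. A \<noteq> matrix_blinfun M \<and> norm (matrix_blinfun M - A) < \<epsilon> \<and> norm A = 1 \<and>
    norm_attainment_set (matrix_blinfun M) = norm_attainment_set A"
proof -
  define r where "r = vertex_values M"
  have cols: "(\<Sum>i\<in>UNIV. \<bar>r i j\<bar>) \<le> 1" for j
    using vertex_values_sum_le_norm[of M j] norm by (simp add: r_def)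
  have D': "(\<Sum>j\<in>UNIV. D i j) = 0"
    "(\<Sum>i\<in>UNIV. \<bar>r i j\<bar>) = 1 \<Longrightarrow> r i j = 0 \<Longrightarrow> D i j = 0"
    "(\<Sum>i\<in>UNIV. \<bar>r i j\<bar>) = 1 \<Longrightarrow> (\<Sum>i\<in>UNIV. sgn (r i j) * D i j) = 0" for i j
    using D(1) by (auto simp: column_preserving_def r_def)
  obtain S where S: "vertex_values S = D"
    using exists_matrix_vertex_values[of D] D'(1) by blast
  have lim: "((\<lambda>h. r i j + h * D i j) \<longlongrightarrow> r i j + 0 * D i j) (at_right 0)" for i j
    by (intro tendsto_intros)
  have "\<forall>\<^sub>F h in at_right 0. r i j \<noteq> 0 \<longrightarrow> sgn (r i j + h * D i j) = sgn (r i j)" for i j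
  proof (cases "r i j" "0 :: real" rule: linorder_cases)
    case less
    with order_tendstoD(2)[OF lim[of i j], of 0] show ?thesis
      by (auto elim!: eventually_mono)
  next
    case greater
    with order_tendstoD(1)[OF lim[of i j], of 0] show ?thesis
      by (auto elim!: eventually_mono)
  qed simp
  then have ev1: "\<forall>\<^sub>F h in at_right 0. \<forall>i j. r i j \<noteq> 0 \<longrightarrow> sgn (r i j + h * D i j) = sgn (r i j)"
    by (intro eventually_all_finite)
  have "\<forall>\<^sub>F h in at_right 0. (\<Sum>i\<in>UNIV. \<bar>r i j\<bar>) < 1 \<longrightarrow> (\<Sum>i\<in>UNIV. \<bar>r i j + h * D i j\<bar>) < 1" for j
  proof (cases "(\<Sum>i\<in>UNIV. \<bar>r i j\<bar>) < 1")
    case True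
    have "((\<lambda>h. \<Sum>i\<in>UNIV. \<bar>r i j + h * D i j\<bar>) \<longlongrightarrow> (\<Sum>i\<in>UNIV. \<bar>r i j + 0 * D i j\<bar>)) (at_right 0)"
      by (intro tendsto_intros)
    from order_tendstoD(2)[OF this, of 1] True show ?thesis
      by (auto elim!: eventually_mono)
  qed simp
  then have ev2: "\<forall>\<^sub>F h in at_right 0. \<forall>j. (\<Sum>i\<in>UNIV. \<bar>r i j\<bar>) < 1 \<longrightarrow>
      (\<Sum>i\<in>UNIV. \<bar>r i j + h * D i j\<bar>) < 1"
    by (rule eventually_all_finite)
  note ev3 = eventually_small_perturbation[OF \<open>\<epsilon> > 0\<close>, of "matrix_blinfun M" "matrix_blinfun S"]
  have "\<forall>\<^sub>F h in at_right 0. (\<forall>i j. r i j \<noteq> 0 \<longrightarrow> sgn (r i j + h * D i j) = sgn (r i j)) \<and>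
      (\<forall>j. (\<Sum>i\<in>UNIV. \<bar>r i j\<bar>) < 1 \<longrightarrow> (\<Sum>i\<in>UNIV. \<bar>r i j + h * D i j\<bar>) < 1) \<and>
      norm (matrix_blinfun M - (matrix_blinfun M + h *\<^sub>R matrix_blinfun S)) < \<epsilon> \<and> h > 0"
    using ev1 ev2 ev3 eventually_at_right_less by eventually_elim blast
  then obtain h where sgn_h: "\<And>i j. r i j \<noteq> 0 \<Longrightarrow> sgn (r i j + h * D i j) = sgn (r i j)"
    and inactive: "\<And>j. (\<Sum>i\<in>UNIV. \<bar>r i j\<bar>) < 1 \<Longrightarrow> (\<Sum>i\<in>UNIV. \<bar>r i j + h * D i j\<bar>) < 1"
    and close: "norm (matrix_blinfun M - (matrix_blinfun M + h *\<^sub>R matrix_blinfun S)) < \<epsilon>"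
    and "h > 0"
    using eventually_happens'[OF trivial_limit_at_right_real] by blast
  define N where "N = M + h *\<^sub>R S"
  define r' where "r' = vertex_values N"
  have N_blinfun: "matrix_blinfun N = matrix_blinfun M + h *\<^sub>R matrix_blinfun S"
    by (simp add: N_def matrix_blinfun_add_scaleR)
  have r'_eq: "r' i j = r i j + h * D i j" for i j
    by (simp add: r'_def r_def N_def vertex_values_def inner_add_left flip: S)
  \<comment> \<open>In an active column even the zero entries keep their sign, because
    \<open>D\<close> vanishes there.\<close>
  have sgn_r': "sgn (r' i j) = sgn (r i j)" if "(\<Sum>i\<in>UNIV. \<bar>r i j\<bar>) = 1" for i j
    using sgn_h[of i j] D'(2)[OF that, of i] by (cases "r i j = 0") (simp_all add: r'_eq)
  have active: "(\<Sum>i\<in>UNIV. \<bar>r' i j\<bar>) = 1" if "(\<Sum>i\<in>UNIV. \<bar>r i j\<bar>) = 1" for j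
  proof -
    \<comment> \<open>With the signs fixed, absolute values change linearly, and the linear terms
      sum to 0 in an active column.\<close>
    have "\<bar>r' i j\<bar> = \<bar>r i j\<bar> + h * (sgn (r i j) * D i j)" for i
    proof -
      have "\<bar>r' i j\<bar> = sgn (r i j) * r' i j" using abs_sgn[of "r' i j"] sgn_r'[OF that] by simp
      also have "\<dots> = \<bar>r i j\<bar> + h * (sgn (r i j) * D i j)"
        by (simp add: r'_eq abs_sgn algebra_simps)
      finally show ?thesis .
    qed
    then show ?thesis
      by (simp add: sum.distrib that D'(3)[OF that] flip: sum_distrib_left)
  qed
  have dichotomy: "(\<Sum>i\<in>UNIV. \<bar>r i j\<bar>) = 1 \<and> (\<Sum>i\<in>UNIV. \<bar>r' i j\<bar>) = 1 \<or>
      (\<Sum>i\<in>UNIV. \<bar>r i j\<bar>) < 1 \<and> (\<Sum>i\<in>UNIV. \<bar>r' i j\<bar>) < 1" for j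
    unfolding r'_eq using active[of j, unfolded r'_eq] inactive[of j] cols[of j] by linarith
  have iff: "(\<Sum>i\<in>UNIV. \<bar>r' i j\<bar>) = 1 \<longleftrightarrow> (\<Sum>i\<in>UNIV. \<bar>r i j\<bar>) = 1" for j
    using dichotomy[of j] by auto
  have cols': "(\<Sum>i\<in>UNIV. \<bar>r' i j\<bar>) \<le> 1" for j
    using dichotomy[of j] by auto
  have scaled: "column_preserving r (\<lambda>i j. c * D i j)" for c
    using D' by (simp add: column_preserving_def mult.left_commute[of _ c] flip: sum_distrib_left)
  \<comment> \<open>The new array has the same active columns, with the same signs in them, so the
    reverse move is admissible for it.\<close>
  have pres': "column_preserving r' (\<lambda>i j. (- h) * D i j)"
    unfolding column_preserving_def
  proof (intro conjI allI impI)
    show "(\<Sum>j\<in>UNIV. (- h) * D i j) = 0" for i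
      using scaled[of "- h"] by (simp only: column_preserving_def)
    fix j
    assume "(\<Sum>i\<in>UNIV. \<bar>r' i j\<bar>) = 1"
    then have act: "(\<Sum>i\<in>UNIV. \<bar>r i j\<bar>) = 1" using iff by blast
    show "(\<Sum>i\<in>UNIV. sgn (r' i j) * ((- h) * D i j)) = 0"
      using scaled[of "- h"] act by (simp only: column_preserving_def sgn_r'[OF act])
    show "(- h) * D i j = 0" if "r' i j = 0" for i
    proof -
      have "r i j = 0" using sgn_r'[OF act, of i] that by (simp add: sgn_zero_iff)
      then show ?thesis using D'(2)[OF act] by simp
    qed
  qed
  \<comment> \<open>An active column is what keeps the norm of \<open>N\<close> from dropping below
    1; one exists because the norm of \<open>M\<close> is at most the largest absolute column
    sum.\<close>
  have "\<exists>j. (\<Sum>i\<in>UNIV. \<bar>r i j\<bar>) = 1"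
  proof (rule ccontr)
    assume "\<not> ?thesis"
    then have less: "(\<Sum>i\<in>UNIV. \<bar>r i j\<bar>) < 1" for j using cols[of j] by (simp add: less_le)
    define m where "m = Max (range (\<lambda>j. \<Sum>i\<in>UNIV. \<bar>r i j\<bar>))"
    have "m \<in> range (\<lambda>j. \<Sum>i\<in>UNIV. \<bar>r i j\<bar>)"
      unfolding m_def by (intro Max_in) auto
    then have "m < 1" using less by auto
    moreover have "norm (matrix_blinfun M) \<le> m"
      unfolding m_def by (rule norm_matrix_blinfun_le) (simp add: r_def)
    ultimately show False using norm by simp
  qed
  then obtain j where "(\<Sum>i\<in>UNIV. \<bar>r' i j\<bar>) = 1" using active by blast
  then have norm': "norm (matrix_blinfun N) = 1"
    using norm_matrix_blinfun_le[of N 1] vertex_values_sum_le_norm[of N j] cols'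
    by (simp add: r'_def)
  have "norm_attainment_set (matrix_blinfun M) = norm_attainment_set (matrix_blinfun N)"
  proof (rule norm_attainment_set_eqI[OF norm norm'])
    show "1 \<le> norm (matrix_blinfun N x)" if "norm x = 1" "norm (matrix_blinfun M x) = 1" for x
      by (rule norm_ge_1_of_column_preserving[OF _ scaled[unfolded r_def, of h] _ that])
        (use cols r'_eq in \<open>simp_all add: r_def r'_def\<close>)
    show "1 \<le> norm (matrix_blinfun M x)" if "norm x = 1" "norm (matrix_blinfun N x) = 1" for x
      by (rule norm_ge_1_of_column_preserving[OF _ pres'[unfolded r'_def] _ that])
        (use cols' r'_eq in \<open>simp_all add: r_def r'_def\<close>)
  qed
  moreover have "matrix_blinfun N \<noteq> matrix_blinfun M"
  proof
    assume "matrix_blinfun N = matrix_blinfun M"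
    then have "r' = r" by (simp add: matrix_blinfun_inject r'_def r_def)
    then have "h * D i j = 0" for i j using r'_eq[of i j] by simp
    then show False using D(2) \<open>h > 0\<close> by (auto simp: fun_eq_iff)
  qed
  ultimately show ?thesis
    using close norm' by (intro exI[of _ "matrix_blinfun N"]) (simp add: N_blinfun)
qed

text \<open>A nonzero row can be split between its own position and that of a zero row.\<close>

lemma exists_approximation_of_zero_row:
  fixes M :: "real ^ 'n::finite ^ 'm::finite"
  assumes norm: "norm (matrix_blinfun M) = 1" and "\<epsilon> > 0" and zero: "M $ i = 0"
  shows "\<exists>A. A \<noteq> matrix_blinfun M \<and> norm (matrix_blinfun M - A) < \<epsilon> \<and> norm A = 1 \<and>
    norm_attainment_set (matrix_blinfun M) = norm_attainment_set A"
proof -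
  have "matrix_blinfun M \<noteq> 0" using norm by auto
  moreover have "matrix_blinfun (0 :: real ^ 'n ^ 'm) = 0"
    using matrix_blinfun_add_scaleR[of 0 1 0] by simp
  ultimately have "M \<noteq> 0" by auto
  then obtain k where k: "M $ k \<noteq> 0"
    by (metis vec_eq_iff zero_index)
  with zero have "k \<noteq> i" by auto
  \<comment> \<open>Adding \<open>h\<close> times \<open>S\<close> replaces rows \<open>0\<close>
    and \<open>M $ k\<close> by the fractions \<open>h\<close> and \<open>1 - h\<close> of
    \<open>M $ k\<close>. For \<open>h\<close> between 0 and 1 the absolute values add up as before,
    so the norm of every image is unchanged.\<close>
  define S where "S = (\<chi> l. if l = i then M $ k else if l = k then - M $ k else 0)"
  have "\<forall>\<^sub>F h in at_right (0 :: real). h < 1"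
    by (rule order_tendstoD(2)[OF tendsto_ident_at]) simp
  then have "\<exists>h. h < 1 \<and> norm (matrix_blinfun M - (matrix_blinfun M + h *\<^sub>R matrix_blinfun S)) < \<epsilon> \<and> h > 0"
    by (intro eventually_happens'[of "at_right (0 :: real)"] trivial_limit_at_right_real
        eventually_conj eventually_small_perturbation eventually_at_right_less \<open>\<epsilon> > 0\<close>)
  then obtain h where h: "h < 1" "h > 0"
    and close: "norm (matrix_blinfun M - (matrix_blinfun M + h *\<^sub>R matrix_blinfun S)) < \<epsilon>"
    by blast
  define N where "N = M + h *\<^sub>R S"
  have N: "N $ i = h *\<^sub>R M $ k" "N $ k = (1 - h) *\<^sub>R M $ k"
    "l \<noteq> i \<Longrightarrow> l \<noteq> k \<Longrightarrow> N $ l = M $ l" for l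
    using zero \<open>k \<noteq> i\<close> by (simp_all add: N_def S_def algebra_simps)
  have norm_eq: "norm (matrix_blinfun N x) = norm (matrix_blinfun M x)" for x
  proof -
    have "(\<Sum>l\<in>UNIV. \<bar>N $ l \<bullet> linf_vec x\<bar> - \<bar>M $ l \<bullet> linf_vec x\<bar>) =
        (\<bar>N $ i \<bullet> linf_vec x\<bar> - \<bar>M $ i \<bullet> linf_vec x\<bar>) + (\<bar>N $ k \<bullet> linf_vec x\<bar> - \<bar>M $ k \<bullet> linf_vec x\<bar>)"
      by (rule sum_two_support) (use \<open>k \<noteq> i\<close> N in auto)
    also have "\<dots> = 0"
      using h by (simp add: N zero abs_mult) (simp add: algebra_simps)
    finally show ?thesis
      by (simp add: norm_matrix_blinfun_apply sum_subtractf)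
  qed
  have norm': "norm (matrix_blinfun N) = 1"
    using norm by (simp add: norm_blinfun.rep_eq onorm_def norm_eq)
  have "N \<noteq> M"
  proof
    assume "N = M"
    then have "h *\<^sub>R M $ k = 0" using N(1) zero by simp
    then show False using h k by simp
  qed
  moreover have "norm_attainment_set (matrix_blinfun M) = norm_attainment_set (matrix_blinfun N)"
    by (simp add: norm_attainment_set_def norm_eq norm norm')
  ultimately show ?thesis
    using close norm' by (intro exI[of _ "matrix_blinfun N"])
      (simp add: matrix_blinfun_inject, simp add: N_def matrix_blinfun_add_scaleR)
qed

theorem corollary4p9:
  shows "nontrivial_norm_preserving_uniform_BPB_property TYPE(3 linf) TYPE(3 l1)"
  unfolding nontrivial_norm_preserving_uniform_BPB_property_def
proof (intro allI impI)
  fix T :: "3 linf \<Rightarrow>\<^sub>L 3 l1" and \<epsilon> :: real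
  assume T: "T \<in> sphere 0 1 - linear_isometries" and "\<epsilon> > 0"
  obtain M where M: "T = matrix_blinfun M" using matrix_blinfun_surj by blast
  have norm: "norm (matrix_blinfun M) = 1" using T M by simp
  have "\<exists>A. A \<noteq> T \<and> norm (T - A) < \<epsilon> \<and> norm A = 1 \<and>
      norm_attainment_set T = norm_attainment_set A"
  proof (cases "\<exists>i. M $ i = 0")
    case True
    then show ?thesis
      unfolding M using exists_approximation_of_zero_row[OF norm \<open>\<epsilon> > 0\<close>] by blast
  next
    case False
    \<comment> \<open>The vertices span the space, so a nonzero row of \<open>M\<close> is nonzero
      at one of them.\<close>
    have "\<exists>j. vertex_values M i j \<noteq> 0" for i
      using False inner_all_cube_vertex_eq_0[of "M $ i"] by (auto simp: vertex_values_def)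
    moreover have "(\<Sum>i\<in>UNIV. \<bar>vertex_values M i j\<bar>) \<le> 1" for j
      using vertex_values_sum_le_norm[of M j] norm by simp
    ultimately obtain D where "column_preserving (vertex_values M) D" "D \<noteq> (\<lambda>i j. 0)"
      using exists_column_preserving[of "vertex_values M"] sum_vertex_values by blast
    then show ?thesis
      unfolding M using exists_approximation_of_column_preserving[OF norm \<open>\<epsilon> > 0\<close>] by blast
  qed
  then obtain A where "A \<noteq> T" "norm (T - A) < \<epsilon>" "norm A = 1"
    "norm_attainment_set T = norm_attainment_set A"
    by blast
  moreover from this have "uniform_BPB_approximation \<epsilon> T A"
    using uniform_BPB_approximation_of_attainment_eq[OF compact_sphere_linf, of T A \<epsilon>]
      norm M \<open>\<epsilon> > 0\<close> by simp
  ultimately show "\<exists>A. nontrivial_uniform_BPB_approximation \<epsilon> T A \<and>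
      norm_attainment_set T = norm_attainment_set A"
    unfolding nontrivial_uniform_BPB_approximation_def by blast
qed

end
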